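(* Let $(M,\mathcal{M},\mu)$ be a $\sigma$-finite measure space, $\mathfrak{Z}$ an $\mathbb{F}$-Fréchet space, and $\psi:M\to\mathfrak{Z}'$ a $\mathfrak{Z}'$-Gelfand $\mu$-integrable map. Assume additionally that $\mathfrak{Z}$ is Montel. Then the map $[E]\mapsto\int_E\psi(x)\,\mu(dx)$ is continuous from $(\mathcal{M}/{\sim},d_\mu)$ into $(\mathfrak{Z}',\beta(\mathfrak{Z}',\mathfrak{Z}))$.
   Context: $\mathbb{F}\in\{\mathbb{R},\mathbb{C}\}$. A Fréchet space is a metrizable, complete, locally convex topological vector space over $\mathbb{F}$; $\mathfrak{Z}'$ is its topological dual and $\langle z',z\rangle$ the dual pairing of $z'\in\mathfrak{Z}'$, $z\in\mathfrak{Z}$. The strong topology $\beta(\mathfrak{Z}',\mathfrak{Z})$ on $\mathfrak{Z}'$ is induced by the seminorms $p_B(z')=\sup_{z\in B}|\langle z',z\rangle|$, with $B$ ranging over all bounded subsets of $\mathfrak{Z}$. A topological vector space is Montel if it is barrelled (locally convex and every radial (absorbing), convex, circled (balanced), closed subset is a neighborhood of $0$) and every closed bounded subset is compact. A map $\psi:M\to\mathfrak{Z}'$ is $\mathfrak{Z}'$-Gelfand $\mu$-integrable if $x\mapsto\langle\psi(x),z\rangle$ belongs to $L^1(\mu)$ for every $z\in\mathfrak{Z}$. For such $\psi$ and $E\in\mathcal{M}$, the Gelfand integral $\int_E\psi(x)\,\mu(dx)$ is the element of $\mathfrak{Z}'$ given by $z\mapsto\int_E\langle\psi(x),z\rangle\,\mu(dx)$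 (this functional is continuous). The relation $\sim$ on $\mathcal{M}$ is $E\sim\tilde{E}$ iff $\mu(E\Delta\tilde{E})=0$, where $\Delta$ is symmetric difference; $[E]$ is the class of $E$. The Fréchet–Nikodym metric on $\mathcal{M}/{\sim}$ is $d_\mu([E],[\tilde{E}]):=\mu(E\Delta\tilde{E})\in[0,\infty]$ (the value $\infty$ is allowed). The integral $\int_E\psi\,d\mu$ depends only on the class $[E]$. *)

theory Defs
  imports "HOL-Analysis.Analysis"
begin

section \<open>The scalar field\<close>

text \<open>The types of this class are exactly the copies of the real and of the complex numbers (with
  their usual absolute value). Completeness and second countability follow from the last axiom;
  they are listed because the library's Bochner integral asks for these sorts.\<close>

class real_or_complex = real_normed_field + banach + second_countable_topology +
  assumes real_or_complex:
    "\<exists>\<phi> :: 'a \<Rightarrow> complex. (\<forall>x y. \<phi> (x + y) = \<phi> x + \<phi> y) \<and>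
       (\<forall>x y. \<phi> (x * y) = \<phi> x * \<phi> y) \<and>
       (\<forall>x. norm (\<phi> x) = norm x) \<and> (range \<phi> = \<real> \<or> range \<phi> = UNIV)"

instance real :: real_or_complex
proof
  have "range complex_of_real = \<real>"
    by (simp add: Reals_def)
  then show "\<exists>\<phi> :: real \<Rightarrow> complex. (\<forall>x y. \<phi> (x + y) = \<phi> x + \<phi> y) \<and>
       (\<forall>x y. \<phi> (x * y) = \<phi> x * \<phi> y) \<and>
       (\<forall>x. norm (\<phi> x) = norm x) \<and> (range \<phi> = \<real> \<or> range \<phi> = UNIV)"
    by (intro exI[of _ complex_of_real]) auto
qed

instance complex :: real_or_complex
proof
  show "\<exists>\<phi> :: complex \<Rightarrow> complex. (\<forall>x y. \<phi> (x + y) = \<phi> x + \<phi> y) \<and>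
       (\<forall>x y. \<phi> (x * y) = \<phi> x * \<phi> y) \<and>
       (\<forall>x. norm (\<phi> x) = norm x) \<and> (range \<phi> = \<real> \<or> range \<phi> = UNIV)"
    by (intro exI[of _ "\<lambda>z. z"]) auto
qed


section \<open>Topological vector spaces\<close>

text \<open>Addition is continuous by the sort of the underlying type. The Hausdorff property is
  not required here.\<close>

locale topological_vector_space = vector_space smul
  for smul :: "'f::real_or_complex \<Rightarrow> 'z::topological_ab_group_add \<Rightarrow> 'z" +
  assumes continuous_scale: "continuous_on UNIV (\<lambda>(c, z). smul c z)"

definition tvs_convex :: "('f::real_or_complex \<Rightarrow> 'z::ab_group_add \<Rightarrow> 'z) \<Rightarrow> 'z set \<Rightarrow> bool" where
  "tvs_convex smul S \<longleftrightarrow>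
     (\<forall>x\<in>S. \<forall>y\<in>S. \<forall>t::real. 0 \<le> t \<longrightarrow> t \<le> 1 \<longrightarrow>
        smul (of_real (1 - t)) x + smul (of_real t) y \<in> S)"

definition circled :: "('f::real_or_complex \<Rightarrow> 'z \<Rightarrow> 'z) \<Rightarrow> 'z set \<Rightarrow> bool" where
  "circled smul S \<longleftrightarrow> (\<forall>c. norm c \<le> 1 \<longrightarrow> smul c ` S \<subseteq> S)"

definition absorbs :: "('f::real_or_complex \<Rightarrow> 'z \<Rightarrow> 'z) \<Rightarrow> 'z set \<Rightarrow> 'z set \<Rightarrow> bool" where
  "absorbs smul A B \<longleftrightarrow> (\<exists>r>0. \<forall>c. r \<le> norm c \<longrightarrow> B \<subseteq> smul c ` A)"

definition radial :: "('f::real_or_complex \<Rightarrow> 'z \<Rightarrow> 'z) \<Rightarrow> 'z set \<Rightarrow> bool" where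
  "radial smul A \<longleftrightarrow> (\<forall>z. absorbs smul A {z})"

text \<open>Throughout, \<^term>\<open>0 \<in> interior U\<close> says that \<^term>\<open>U\<close> is a neighbourhood of 0.\<close>

definition tvs_bounded ::
    "('f::real_or_complex \<Rightarrow> 'z::{ab_group_add, topological_space} \<Rightarrow> 'z) \<Rightarrow> 'z set \<Rightarrow> bool" where
  "tvs_bounded smul B \<longleftrightarrow> (\<forall>U. 0 \<in> interior U \<longrightarrow> absorbs smul U B)"

definition locally_convex ::
    "('f::real_or_complex \<Rightarrow> 'z::{ab_group_add, topological_space} \<Rightarrow> 'z) \<Rightarrow> bool" where
  "locally_convex smul \<longleftrightarrow>
     (\<forall>U. 0 \<in> interior U \<longrightarrow> (\<exists>V. 0 \<in> interior V \<and> tvs_convex smul V \<and> V \<subseteq> U))"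

text \<open>Completeness for the uniform structure of the additive group: every Cauchy filter converges.\<close>

definition group_cauchy_filter :: "'z::{ab_group_add, topological_space} filter \<Rightarrow> bool" where
  "group_cauchy_filter F \<longleftrightarrow> F \<times>\<^sub>F F \<le> filtercomap (\<lambda>(x, y). x - y) (nhds 0)"

definition group_complete :: "'z::{ab_group_add, topological_space} itself \<Rightarrow> bool" where
  "group_complete _ \<longleftrightarrow>
     (\<forall>F :: 'z filter. F \<noteq> bot \<longrightarrow> group_cauchy_filter F \<longrightarrow> (\<exists>z. F \<le> nhds z))"

locale frechet_space = topological_vector_space smul
  for smul :: "'f::real_or_complex \<Rightarrow> 'z::topological_ab_group_add \<Rightarrow> 'z" +
  assumes metrizable: "metrizable_space (euclidean :: 'z topology)"
    and complete: "group_complete TYPE('z)"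
    and locally_convex: "locally_convex smul"

locale barrelled_space = topological_vector_space smul
  for smul :: "'f::real_or_complex \<Rightarrow> 'z::topological_ab_group_add \<Rightarrow> 'z" +
  assumes locally_convex: "locally_convex smul"
    and barrel_neighbourhood:
      "\<And>U. radial smul U \<Longrightarrow> tvs_convex smul U \<Longrightarrow> circled smul U \<Longrightarrow> closed U \<Longrightarrow> 0 \<in> interior U"

locale montel_space = barrelled_space smul
  for smul :: "'f::real_or_complex \<Rightarrow> 'z::topological_ab_group_add \<Rightarrow> 'z" +
  assumes closed_bounded_compact: "\<And>S. closed S \<Longrightarrow> tvs_bounded smul S \<Longrightarrow> compact S"


section \<open>The strong dual\<close>

definition topological_dual ::
    "('f::real_or_complex \<Rightarrow> 'z::topological_ab_group_add \<Rightarrow> 'z) \<Rightarrow> ('z \<Rightarrow> 'f) set" where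
  "topological_dual smul = {f. Vector_Spaces.linear smul (*) f \<and> continuous_on UNIV f}"

text \<open>The supremum is taken in the extended nonnegative reals, so that it is 0 for the empty set.
  It is finite for bounded sets and continuous functionals, see below.\<close>

definition dual_seminorm :: "'z set \<Rightarrow> ('z \<Rightarrow> 'f::real_normed_vector) \<Rightarrow> ennreal" where
  "dual_seminorm B f = (SUP z\<in>B. ennreal (norm (f z)))"

definition strong_topology ::
    "('f::real_or_complex \<Rightarrow> 'z::topological_ab_group_add \<Rightarrow> 'z) \<Rightarrow> ('z \<Rightarrow> 'f) topology" where
  "strong_topology smul = topology_generated_by
     {{g \<in> topological_dual smul. dual_seminorm B (\<lambda>z. g z - f z) < e} | B f e.
        tvs_bounded smul B \<and> f \<in> topological_dual smul \<and> 0 < e}"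

lemma dual_seminorm_finite:
  assumes B: "tvs_bounded smul B" and f: "f \<in> topological_dual smul"
  shows "dual_seminorm B f < \<infinity>"
proof -
  interpret f: Vector_Spaces.linear smul "(*)" f
    using f by (simp add: topological_dual_def)
  let ?U = "f -` ball 0 1"
  have "open ?U"
    using f by (auto simp: topological_dual_def intro: open_vimage)
  then have "0 \<in> interior ?U"
    by (simp add: interior_open f.zero)
  then obtain r where r: "r > 0" "\<And>c. r \<le> norm c \<Longrightarrow> B \<subseteq> smul c ` ?U"
    using B by (auto simp: tvs_bounded_def absorbs_def)
  have "norm (f z) \<le> r" if "z \<in> B" for z
  proof -
    have "z \<in> smul (of_real r) ` ?U"
      using r(2)[of "of_real r"] r(1) that by auto
    then obtain u where "z = smul (of_real r) u" "norm (f u) < 1"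
      unfolding image_iff by (metis dist_0_norm mem_ball vimageE)
    then show ?thesis
      using r(1) by (simp add: f.scale norm_mult)
  qed
  then have "dual_seminorm B f \<le> ennreal r"
    unfolding dual_seminorm_def by (intro SUP_least ennreal_leI)
  then show ?thesis
    using order_le_less_trans by fastforce
qed

lemma topspace_strong_topology: "topspace (strong_topology smul) = topological_dual smul"
proof -
  have "f \<in> topspace (strong_topology smul)" if "f \<in> topological_dual smul" for f
  proof -
    let ?S = "{g \<in> topological_dual smul. dual_seminorm {} (\<lambda>z. g z - f z) < 1}"
    have "tvs_bounded smul {}"
      by (auto simp: tvs_bounded_def absorbs_def intro: exI[of _ 1])
    then have "openin (strong_topology smul) ?S"
      unfolding strong_topology_def using that zero_less_one
      by (intro topology_generated_by_Basis) blast
    moreover have "f \<in> ?S"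
      using that by (simp add: dual_seminorm_def bot_ennreal)
    ultimately show ?thesis
      using openin_subset by blast
  qed
  moreover have "topspace (strong_topology smul) \<subseteq> topological_dual smul"
    unfolding strong_topology_def topology_generated_by_topspace by auto
  ultimately show ?thesis by auto
qed


section \<open>The Gelfand integral\<close>

definition gelfand_integrable ::
    "('f::real_or_complex \<Rightarrow> 'z::topological_ab_group_add \<Rightarrow> 'z) \<Rightarrow> 'm measure \<Rightarrow> ('m \<Rightarrow> 'z \<Rightarrow> 'f) \<Rightarrow> bool"
  where
  "gelfand_integrable smul M \<psi> \<longleftrightarrow>
     (\<forall>x\<in>space M. \<psi> x \<in> topological_dual smul) \<and> (\<forall>z. integrable M (\<lambda>x. \<psi> x z))"

definition gelfand_integral :: "'m measure \<Rightarrow> ('m \<Rightarrow> 'z \<Rightarrow> 'f::real_or_complex) \<Rightarrow> 'm set \<Rightarrow> 'z \<Rightarrow> 'f" where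
  "gelfand_integral M \<psi> E = (\<lambda>z. set_lebesgue_integral M E (\<lambda>x. \<psi> x z))"


section \<open>The Frechet--Nikodym metric\<close>

definition nikodym_rel :: "'m measure \<Rightarrow> ('m set \<times> 'm set) set" where
  "nikodym_rel M = {(E, F). E \<in> sets M \<and> F \<in> sets M \<and> emeasure M (sym_diff E F) = 0}"

text \<open>Functions of classes are given by the common value on the representatives; the lemmas
  below show that there is one.\<close>

definition nikodym_dist :: "'m measure \<Rightarrow> 'm set set \<Rightarrow> 'm set set \<Rightarrow> ennreal" where
  "nikodym_dist M A B = the_elem ((\<lambda>(E, F). emeasure M (sym_diff E F)) ` (A \<times> B))"

definition gelfand_integral_class ::
    "'m measure \<Rightarrow> ('m \<Rightarrow> 'z \<Rightarrow> 'f::real_or_complex) \<Rightarrow> 'm set set \<Rightarrow> 'z \<Rightarrow> 'f" where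
  "gelfand_integral_class M \<psi> A = the_elem (gelfand_integral M \<psi> ` A)"

text \<open>The topology of a metric on \<^term>\<open>C\<close> that may take the value \<^term>\<open>\<infinity>\<close>.\<close>

definition emetric_topology :: "'c set \<Rightarrow> ('c \<Rightarrow> 'c \<Rightarrow> ennreal) \<Rightarrow> 'c topology" where
  "emetric_topology C d =
     topology (\<lambda>U. U \<subseteq> C \<and> (\<forall>x\<in>U. \<exists>e>0. \<forall>y\<in>C. d x y < e \<longrightarrow> y \<in> U))"

definition nikodym_topology :: "'m measure \<Rightarrow> 'm set set topology" where
  "nikodym_topology M = emetric_topology (sets M // nikodym_rel M) (nikodym_dist M)"

lemma openin_emetric_topology:
  "openin (emetric_topology C d) U \<longleftrightarrow> U \<subseteq> C \<and> (\<forall>x\<in>U. \<exists>e>0. \<forall>y\<in>C. d x y < e \<longrightarrow> y \<in> U)"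
proof -
  have "istopology (\<lambda>U. U \<subseteq> C \<and> (\<forall>x\<in>U. \<exists>e>0. \<forall>y\<in>C. d x y < e \<longrightarrow> y \<in> U))"
    unfolding istopology_def
  proof (intro conjI allI impI ballI)
    fix S T x
    assume S: "S \<subseteq> C \<and> (\<forall>x\<in>S. \<exists>e>0. \<forall>y\<in>C. d x y < e \<longrightarrow> y \<in> S)"
      and T: "T \<subseteq> C \<and> (\<forall>x\<in>T. \<exists>e>0. \<forall>y\<in>C. d x y < e \<longrightarrow> y \<in> T)"
      and x: "x \<in> S \<inter> T"
    obtain e where "e > 0" "\<forall>y\<in>C. d x y < e \<longrightarrow> y \<in> S" using S x by blast
    moreover obtain e' where "e' > 0" "\<forall>y\<in>C. d x y < e' \<longrightarrow> y \<in> T" using T x by blast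
    ultimately show "\<exists>e>0. \<forall>y\<in>C. d x y < e \<longrightarrow> y \<in> S \<inter> T"
      by (intro exI[of _ "min e e'"]) auto
  next
    fix K x
    assume K: "\<forall>S\<in>K. S \<subseteq> C \<and> (\<forall>x\<in>S. \<exists>e>0. \<forall>y\<in>C. d x y < e \<longrightarrow> y \<in> S)" and "x \<in> \<Union> K"
    then obtain S where S: "S \<in> K" "x \<in> S" by blast
    then obtain e where "e > 0" "\<forall>y\<in>C. d x y < e \<longrightarrow> y \<in> S" using K by blast
    then show "\<exists>e>0. \<forall>y\<in>C. d x y < e \<longrightarrow> y \<in> \<Union> K"
      using S by blast
  qed auto
  then show ?thesis
    by (simp add: emetric_topology_def)
qed

lemma topspace_emetric_topology: "topspace (emetric_topology C d) = C"
proof (rule antisym)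
  show "topspace (emetric_topology C d) \<subseteq> C"
    using openin_topspace[of "emetric_topology C d"] unfolding openin_emetric_topology by (rule conjunct1)
  have "openin (emetric_topology C d) C"
    unfolding openin_emetric_topology using zero_less_one by blast
  then show "C \<subseteq> topspace (emetric_topology C d)"
    by (rule openin_subset)
qed

lemma nikodym_rel_iff:
  "(E, F) \<in> nikodym_rel M \<longleftrightarrow> E \<in> sets M \<and> F \<in> sets M \<and> sym_diff E F \<in> null_sets M"
  by (auto simp: nikodym_rel_def null_sets_def)

lemma nikodym_rel_AE:
  assumes "(E, F) \<in> nikodym_rel M"
  shows "AE x in M. x \<in> E \<longleftrightarrow> x \<in> F"
proof -
  have "AE x in M. x \<notin> sym_diff E F"
    using assms by (intro AE_not_in) (simp add: nikodym_rel_iff)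
  then show ?thesis by eventually_elim auto
qed

lemma equiv_nikodym_rel: "equiv (sets M) (nikodym_rel M)"
proof (rule equivI)
  show "nikodym_rel M \<subseteq> sets M \<times> sets M" by (auto simp: nikodym_rel_def)
  show "refl_on (sets M) (nikodym_rel M)" by (auto simp: refl_on_def nikodym_rel_def)
  show "sym (nikodym_rel M)" by (auto simp: sym_def nikodym_rel_def Un_commute)
  show "trans (nikodym_rel M)"
  proof (rule transI)
    fix E F G
    assume EF: "(E, F) \<in> nikodym_rel M" and FG: "(F, G) \<in> nikodym_rel M"
    then have "sym_diff E F \<union> sym_diff F G \<in> null_sets M"
      unfolding nikodym_rel_iff by blast
    moreover have "sym_diff E G \<in> sets M"
      using EF FG by (auto simp: nikodym_rel_def)
    ultimately have "sym_diff E G \<in> null_sets M"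
      by (rule null_sets_subset) auto
    then show "(E, G) \<in> nikodym_rel M"
      using EF FG by (simp add: nikodym_rel_iff)
  qed
qed

lemma nikodym_dist_class:
  assumes E: "E \<in> sets M" and F: "F \<in> sets M"
  shows "nikodym_dist M (nikodym_rel M `` {E}) (nikodym_rel M `` {F}) = emeasure M (sym_diff E F)"
proof -
  have "emeasure M (sym_diff E' F') = emeasure M (sym_diff E F)"
    if "(E, E') \<in> nikodym_rel M" "(F, F') \<in> nikodym_rel M" for E' F'
  proof (rule emeasure_eq_AE)
    show "AE x in M. x \<in> sym_diff E' F' \<longleftrightarrow> x \<in> sym_diff E F"
      using nikodym_rel_AE[OF that(1)] nikodym_rel_AE[OF that(2)] by eventually_elim auto
  qed (use E F that in \<open>auto simp: nikodym_rel_def\<close>)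
  then have eq: "(\<lambda>(E, F). emeasure M (sym_diff E F)) p = (\<lambda>(E, F). emeasure M (sym_diff E F)) (E, F)"
    if "p \<in> nikodym_rel M `` {E} \<times> nikodym_rel M `` {F}" for p
    using that by (cases p) (simp only: Image_singleton_iff mem_Times_iff fst_conv snd_conv case_prod_conv)
  have "(E, F) \<in> nikodym_rel M `` {E} \<times> nikodym_rel M `` {F}"
    using E F by (simp add: nikodym_rel_def)
  then have "nikodym_rel M `` {E} \<times> nikodym_rel M `` {F} \<noteq> {}"
    by blast
  from the_elem_image_unique[OF this eq] show ?thesis
    unfolding nikodym_dist_def by (simp only: case_prod_conv)
qed

lemma gelfand_integral_class:
  assumes "gelfand_integrable smul M \<psi>" and E: "E \<in> sets M"
  shows "gelfand_integral_class M \<psi> (nikodym_rel M `` {E}) = gelfand_integral M \<psi> E"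
proof -
  have "gelfand_integral M \<psi> E' = gelfand_integral M \<psi> E" if "(E, E') \<in> nikodym_rel M" for E'
    unfolding gelfand_integral_def
    by (rule ext, rule set_integral_null_delta)
      (use assms that in \<open>auto simp: gelfand_integrable_def nikodym_rel_iff Un_commute\<close>)
  moreover have "(E, E) \<in> nikodym_rel M"
    using E by (auto simp: nikodym_rel_def)
  ultimately have "gelfand_integral M \<psi> ` (nikodym_rel M `` {E}) = {gelfand_integral M \<psi> E}"
    by blast
  then show ?thesis by (simp add: gelfand_integral_class_def)
qed

end

theory Submission
  imports Defs
begin

text \<open>
  Put \<open>q(z) = \<integral> |\<psi>(x)(z)| \<mu>(dx)\<close>. This is a finite seminorm, and by Fatou's lemma it is
  sequentially lower semicontinuous. As the space is metrizable, every set \<open>{q \<le> e}\<close> with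
  \<open>e > 0\<close> is therefore closed, hence a barrel, hence a neighbourhood of 0: \<open>q\<close> is continuous
  (\<open>gelfand_barrel\<close>). In particular the Gelfand integrals, which are dominated by \<open>q\<close>, are
  continuous functionals (\<open>gelfand_integral_in_dual\<close>).

  Let \<open>B\<close> be bounded. Its closure is bounded, hence compact by the Montel property, so it is covered
  by finitely many sets on which \<open>q(z - y) \<le> e/2\<close>, centred at points \<open>y\<close> of a finite set \<open>Y\<close>.
  The integrals of the finitely many functions \<open>|\<psi>(x)(y)|\<close> over a set \<open>D\<close> are at most \<open>e/2\<close> as soon
  as \<open>\<mu>(D)\<close> is small, so the integral of \<open>|\<psi>(x)(z)|\<close> over \<open>D\<close> is at most \<open>e\<close> for all \<open>z \<in> B\<close>
  simultaneously (\<open>gelfand_uniformly_absolutely_continuous\<close>). Since the Gelfand integrals over \<open>E\<close> and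
  \<open>F\<close> differ at \<open>z\<close> by at most the integral of \<open>|\<psi>(x)(z)|\<close> over the symmetric difference of \<open>E\<close>
  and \<open>F\<close>, this is continuity for the seminorm of \<open>B\<close>; it is even uniform in \<open>E\<close>.
\<close>

section \<open>Neighbourhoods and bounded sets\<close>

lemma closed_neighbourhood:
  fixes U :: "'a::topological_ab_group_add set"
  assumes "0 \<in> interior U"
  obtains V where "0 \<in> interior V" "closed V" "V \<subseteq> U"
proof -
  let ?S = "(\<lambda>p::'a \<times> 'a. fst p + snd p) -` interior U"
  have "open ?S"
    by (intro open_vimage continuous_intros) auto
  moreover have "(0, 0) \<in> ?S"
    using assms by simp
  ultimately obtain A B where AB: "open A" "open B" "(0, 0) \<in> A \<times> B" "A \<times> B \<subseteq> ?S"
    by (rule open_prod_elim)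
  define W where "W = A \<inter> B"
  have W: "open W" "0 \<in> W"
    using AB by (auto simp: W_def)
  have sum: "x + y \<in> U" if "x \<in> W" "y \<in> W" for x y
  proof -
    have "(x, y) \<in> ?S"
      using that AB(4) by (auto simp: W_def)
    then show ?thesis
      using interior_subset[of U] by auto
  qed
  have "x \<in> U" if x: "x \<in> closure W" for x
  proof -
    have "open ((\<lambda>y. x - y) -` W)"
      using W(1) by (intro open_vimage continuous_intros) auto
    moreover have "x \<in> (\<lambda>y. x - y) -` W"
      using W(2) by simp
    ultimately have "(\<lambda>y. x - y) -` W \<inter> W \<noteq> {}"
      using x open_Int_closure_eq_empty by blast
    then obtain w where "x - w \<in> W" "w \<in> W"
      by auto
    then show ?thesis
      using sum[of "x - w" w] by simp
  qed
  moreover have "0 \<in> interior (closure W)"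
    using W closure_subset interiorI by metis
  ultimately show ?thesis
    using that[of "closure W"] by auto
qed

lemma (in topological_vector_space) continuous_on_scale_const: "continuous_on UNIV (smul c)"
proof -
  have "continuous_on UNIV (\<lambda>z. (c, z))"
    by (intro continuous_intros)
  then have "continuous_on UNIV (\<lambda>z. (\<lambda>(c, z). smul c z) (c, z))"
    by (rule continuous_on_compose2[OF continuous_scale]) simp
  then show ?thesis
    by simp
qed

lemma (in topological_vector_space) tvs_bounded_closure:
  assumes "tvs_bounded smul B"
  shows "tvs_bounded smul (closure B)"
  unfolding tvs_bounded_def
proof (intro allI impI)
  fix U :: "'z set"
  assume "0 \<in> interior U"
  then obtain V where V: "0 \<in> interior V" "closed V" "V \<subseteq> U"
    by (rule closed_neighbourhood)
  then obtain r where r: "r > 0" "\<And>c. r \<le> norm c \<Longrightarrow> B \<subseteq> smul c ` V"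
    using assms by (auto simp: tvs_bounded_def absorbs_def)
  have "closure B \<subseteq> smul c ` U" if c: "r \<le> norm c" for c
  proof -
    have "c \<noteq> 0"
      using r(1) c by auto
    have "B \<subseteq> smul (inverse c) -` V"
      using r(2)[OF c] \<open>c \<noteq> 0\<close> by auto
    moreover have "closed (smul (inverse c) -` V)"
      using continuous_on_scale_const V(2) by (intro closed_vimage)
    ultimately have "closure B \<subseteq> smul (inverse c) -` V"
      by (rule closure_minimal)
    then show ?thesis
    proof (intro subsetI image_eqI)
      fix x assume "closure B \<subseteq> smul (inverse c) -` V" "x \<in> closure B"
      then show "smul (inverse c) x \<in> U" using V(3) by auto
      show "x = smul c (smul (inverse c) x)" using \<open>c \<noteq> 0\<close> by simp
    qed
  qed
  then show "absorbs smul U (closure B)"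
    using r(1) by (auto simp: absorbs_def)
qed

text \<open>A sequential criterion for closedness in a type that carries no metric, only a metrizable
  topology.\<close>

lemma metrizable_closed_sequentially:
  fixes S :: "'a::topological_space set"
  assumes "metrizable_space (euclidean :: 'a topology)"
    and lim: "\<And>s l. range s \<subseteq> S \<Longrightarrow> s \<longlonglongrightarrow> l \<Longrightarrow> l \<in> S"
  shows "closed S"
proof -
  obtain N d where N: "Metric_space N d" and eq: "(euclidean :: 'a topology) = Metric_space.mtopology N d"
    using assms(1) unfolding metrizable_space_def by blast
  interpret Metric_space N d by (rule N)
  have "N = UNIV"
    using topspace_mtopology unfolding eq[symmetric] by simp
  then have "closedin mtopology S"
    unfolding metric_closedin_iff_sequentially_closed
    using lim unfolding eq[symmetric] by auto
  then show ?thesis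
    unfolding eq[symmetric] by simp
qed

section \<open>Absolute continuity of the integral\<close>

text \<open>The measure need not be finite: up to \<open>e/2\<close> the integral of \<open>u\<close> is that of a truncation
  \<open>min u n\<close>, and the integral of the latter over \<open>D\<close> is at most \<open>n\<close> times the measure of \<open>D\<close>.\<close>

lemma nn_integral_absolutely_continuous:
  fixes u :: "'m \<Rightarrow> ennreal" and e :: real
  assumes [measurable]: "u \<in> borel_measurable M"
    and fin: "(\<integral>\<^sup>+x. u x \<partial>M) < \<infinity>" and e: "0 < e"
  shows "\<exists>\<delta>>0. \<forall>D\<in>sets M. emeasure M D < \<delta> \<longrightarrow> (\<integral>\<^sup>+x\<in>D. u x \<partial>M) \<le> e"
proof -
  let ?u = "\<lambda>n x. min (u x) (of_nat n)"
  have sup: "(SUP n. ?u n x) = u x" for x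
  proof (rule antisym)
    show "u x \<le> (SUP n. ?u n x)"
    proof (cases "u x = \<infinity>")
      case True
      then show ?thesis by (simp add: min_def top_unique ennreal_SUP_of_nat_eq_top)
    next
      case False
      then obtain n where "u x < of_nat n"
        using ennreal_Ex_less_of_nat[of "u x"] by (auto simp: top.not_eq_extremum)
      then have "u x = ?u n x" by (simp add: less_imp_le)
      then show ?thesis by (metis SUP_upper UNIV_I)
    qed
  qed (auto intro: SUP_least)
  have "incseq ?u"
    by (auto simp: incseq_def le_fun_def intro: min.coboundedI2 min.mono)
  then have "(SUP n. \<integral>\<^sup>+x. ?u n x \<partial>M) = (\<integral>\<^sup>+x. u x \<partial>M)"
    by (subst nn_integral_monotone_convergence_SUP[symmetric]) (auto simp: sup)
  then have "(SUP n. (\<integral>\<^sup>+x. ?u n x \<partial>M) + ennreal (e / 2)) = (\<integral>\<^sup>+x. u x \<partial>M) + ennreal (e / 2)"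
    by (subst ennreal_SUP_add_left) auto
  moreover have "(\<integral>\<^sup>+x. u x \<partial>M) < (\<integral>\<^sup>+x. u x \<partial>M) + ennreal (e / 2)"
    using fin e by (cases "\<integral>\<^sup>+x. u x \<partial>M") (auto simp: ennreal_less_iff simp flip: ennreal_plus)
  ultimately obtain n where n: "(\<integral>\<^sup>+x. u x \<partial>M) < (\<integral>\<^sup>+x. ?u n x \<partial>M) + ennreal (e / 2)"
    by (metis (mono_tags, lifting) less_SUP_iff)
  show ?thesis
  proof (intro exI[of _ "ennreal (e / (2 * (real n + 1)))"] conjI ballI impI)
    \<comment> \<open>The summand 1 avoids a division by zero in the case \<open>n = 0\<close>.\<close>
    show "0 < ennreal (e / (2 * (real n + 1)))"
      using e by simp
    fix D assume [measurable]: "D \<in> sets M" and D: "emeasure M D < ennreal (e / (2 * (real n + 1)))"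
    have fin': "(\<integral>\<^sup>+x. ?u n x \<partial>M) < \<infinity>"
      using fin by (rule order_le_less_trans[rotated]) (auto intro!: nn_integral_mono)
    have split: "u x = ?u n x + (u x - ?u n x)" for x
      by (simp add: add_diff_inverse_ennreal)
    have "(\<integral>\<^sup>+x. u x \<partial>M) = (\<integral>\<^sup>+x. ?u n x \<partial>M) + (\<integral>\<^sup>+x. u x - ?u n x \<partial>M)"
      by (subst nn_integral_add[symmetric]) (auto simp flip: split)
    then have rest: "(\<integral>\<^sup>+x. u x - ?u n x \<partial>M) \<le> ennreal (e / 2)"
      using n fin' by (simp add: ennreal_add_left_cancel_less less_imp_le)
    have "(\<integral>\<^sup>+x\<in>D. u x \<partial>M) \<le> (\<integral>\<^sup>+x. of_nat n * indicator D x + (u x - ?u n x) \<partial>M)"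
      by (intro nn_integral_mono, subst split) (auto simp: indicator_def intro!: add_mono)
    also have "\<dots> = of_nat n * emeasure M D + (\<integral>\<^sup>+x. u x - ?u n x \<partial>M)"
      by (subst nn_integral_add) (auto simp: nn_integral_cmult_indicator)
    also have "\<dots> \<le> of_nat n * ennreal (e / (2 * (real n + 1))) + ennreal (e / 2)"
      using D rest by (intro add_mono mult_left_mono) auto
    also have "\<dots> = ennreal (real n * (e / (2 * (real n + 1))) + e / 2)"
      using e unfolding ennreal_of_nat_eq_real_of_nat
      by (subst ennreal_mult[symmetric]) (auto simp flip: ennreal_plus)
    also have "\<dots> \<le> ennreal e"
      using e by (intro ennreal_leI) (simp add: field_simps)
    finally show "(\<integral>\<^sup>+x\<in>D. u x \<partial>M) \<le> e" .
  qed
qed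

section \<open>The seminorm of a Gelfand integrable map\<close>

lemma topological_dual_simps:
  assumes "f \<in> topological_dual smul"
  shows "f (x + y) = f x + f y" "f (x - y) = f x - f y" "f (smul c x) = c * f x"
proof -
  interpret f: Vector_Spaces.linear smul "(*)" f
    using assms by (simp add: topological_dual_def)
  show "f (x + y) = f x + f y" "f (x - y) = f x - f y" "f (smul c x) = c * f x"
    by (simp_all add: f.add f.diff f.scale)
qed

context
  fixes smul :: "'f::real_or_complex \<Rightarrow> 'z::topological_ab_group_add \<Rightarrow> 'z"
    and M :: "'m measure" and \<psi> :: "'m \<Rightarrow> 'z \<Rightarrow> 'f"
  assumes gelf: "gelfand_integrable smul M \<psi>"
begin

lemma gelfand_measurable [measurable]: "(\<lambda>x. \<psi> x z) \<in> borel_measurable M"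
  using gelf by (simp add: gelfand_integrable_def borel_measurable_integrable)

lemma gelfand_simps:
  assumes "x \<in> space M"
  shows "\<psi> x (y + z) = \<psi> x y + \<psi> x z" "\<psi> x (y - z) = \<psi> x y - \<psi> x z" "\<psi> x (smul c z) = c * \<psi> x z"
  using assms gelf by (auto simp: gelfand_integrable_def topological_dual_simps)

lemma gelfand_nn_integral_finite: "(\<integral>\<^sup>+x. norm (\<psi> x z) \<partial>M) < \<infinity>"
  using gelf by (auto simp: gelfand_integrable_def integrable_iff_bounded)

lemma gelfand_nn_integral_scale:
  "(\<integral>\<^sup>+x. norm (\<psi> x (smul c z)) \<partial>M) = norm c * (\<integral>\<^sup>+x. norm (\<psi> x z) \<partial>M)"
proof -
  have "(\<integral>\<^sup>+x. norm (\<psi> x (smul c z)) \<partial>M) = (\<integral>\<^sup>+x. norm c * ennreal (norm (\<psi> x z)) \<partial>M)"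
    by (intro nn_integral_cong) (simp add: gelfand_simps norm_mult ennreal_mult)
  then show ?thesis
    by (simp add: nn_integral_cmult)
qed

lemma gelfand_nn_integral_add:
  "(\<integral>\<^sup>+x. norm (\<psi> x (y + z)) \<partial>M) \<le> (\<integral>\<^sup>+x. norm (\<psi> x y) \<partial>M) + (\<integral>\<^sup>+x. norm (\<psi> x z) \<partial>M)"
proof -
  have "(\<integral>\<^sup>+x. norm (\<psi> x (y + z)) \<partial>M) \<le> (\<integral>\<^sup>+x. ennreal (norm (\<psi> x y)) + ennreal (norm (\<psi> x z)) \<partial>M)"
    by (intro nn_integral_mono)
      (simp add: gelfand_simps norm_triangle_ineq ennreal_leI flip: ennreal_plus)
  then show ?thesis
    by (simp add: nn_integral_add)
qed

lemma gelfand_nn_integral_liminf: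
  assumes "s \<longlonglongrightarrow> l"
  shows "(\<integral>\<^sup>+x. norm (\<psi> x l) \<partial>M) \<le> liminf (\<lambda>n. \<integral>\<^sup>+x. norm (\<psi> x (s n)) \<partial>M)"
proof -
  have "ennreal (norm (\<psi> x l)) = liminf (\<lambda>n. ennreal (norm (\<psi> x (s n))))" if "x \<in> space M" for x
  proof -
    have "continuous_on UNIV (\<psi> x)"
      using that gelf by (simp add: gelfand_integrable_def topological_dual_def)
    then have "(\<lambda>n. \<psi> x (s n)) \<longlonglongrightarrow> \<psi> x l"
      using assms by (rule continuous_on_tendsto_compose) auto
    then have "(\<lambda>n. ennreal (norm (\<psi> x (s n)))) \<longlonglongrightarrow> ennreal (norm (\<psi> x l))"
      by (intro tendsto_ennrealI tendsto_norm)
    then show ?thesis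
      by (intro lim_imp_Liminf[symmetric]) auto
  qed
  then have "(\<integral>\<^sup>+x. norm (\<psi> x l) \<partial>M) = (\<integral>\<^sup>+x. liminf (\<lambda>n. ennreal (norm (\<psi> x (s n)))) \<partial>M)"
    by (rule nn_integral_cong)
  also have "\<dots> \<le> liminf (\<lambda>n. \<integral>\<^sup>+x. norm (\<psi> x (s n)) \<partial>M)"
    by (intro nn_integral_liminf) measurable
  finally show ?thesis .
qed

text \<open>The balls of the seminorm \<open>q(z) = \<integral> |\<psi>(x)(z)| \<mu>(dx)\<close> are barrels. This is the only place
  where metrizability enters, because Fatou's lemma speaks of sequences.\<close>

lemma gelfand_barrel:
  fixes e :: real
  assumes "metrizable_space (euclidean :: 'z topology)" and "barrelled_space smul" and e: "0 < e"
  shows "0 \<in> interior {z. (\<integral>\<^sup>+x. norm (\<psi> x z) \<partial>M) \<le> e}" (is "0 \<in> interior ?U")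
proof -
  interpret barrelled_space smul by fact
  let ?q = "\<lambda>z. \<integral>\<^sup>+x. norm (\<psi> x z) \<partial>M"
  show ?thesis
  proof (rule barrel_neighbourhood)
    show "radial smul ?U"
      unfolding radial_def
    proof
      fix z
      obtain r where r: "?q z = ennreal r" "0 \<le> r"
        using gelfand_nn_integral_finite[of z] by (cases "?q z") auto
      \<comment> \<open>The radius \<open>q(z) / e\<close> would do, except that it may be 0.\<close>
      show "absorbs smul ?U {z}"
        unfolding absorbs_def
      proof (intro exI[of _ "r / e + 1"] conjI allI impI subsetI)
        show "0 < r / e + 1"
          using r(2) e by (simp add: add_nonneg_pos)
        fix c :: 'f and y
        assume c: "r / e + 1 \<le> norm c" and "y \<in> {z}"
        have "norm c > 0"
          using \<open>0 < r / e + 1\<close> c by linarith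
        have "r / e \<le> norm c"
          using c by linarith
        then have "r \<le> e * norm c"
          using e by (simp add: field_simps)
        then have "inverse (norm c) * r \<le> e"
          using \<open>norm c > 0\<close> by (simp add: field_simps)
        then have "smul (inverse c) z \<in> ?U"
          using r by (simp add: gelfand_nn_integral_scale norm_inverse ennreal_leI flip: ennreal_mult)
        moreover have "y = smul c (smul (inverse c) z)"
          using \<open>y \<in> {z}\<close> \<open>norm c > 0\<close> by simp
        ultimately show "y \<in> smul c ` ?U"
          by blast
      qed
    qed
    show "tvs_convex smul ?U"
      unfolding tvs_convex_def
    proof (intro ballI allI impI)
      fix y z and t :: real
      assume y: "y \<in> ?U" and z: "z \<in> ?U" and t: "0 \<le> t" "t \<le> 1"
      have "?q (smul (of_real (1 - t)) y + smul (of_real t) z) \<le> ennreal (1 - t) * ?q y + ennreal t * ?q z"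
        using gelfand_nn_integral_add[of "smul (of_real (1 - t)) y" "smul (of_real t) z"] t
        unfolding gelfand_nn_integral_scale by (simp del: of_real_diff)
      also have "\<dots> \<le> ennreal (1 - t) * ennreal e + ennreal t * ennreal e"
        using y z by (intro add_mono mult_left_mono) auto
      also have "\<dots> = ennreal ((1 - t) * e + t * e)"
        using t e by (simp add: ennreal_mult ennreal_plus)
      also have "\<dots> = ennreal e"
        by (simp add: algebra_simps)
      finally show "smul (of_real (1 - t)) y + smul (of_real t) z \<in> ?U"
        by simp
    qed
    show "circled smul ?U"
      unfolding circled_def
    proof (intro allI impI image_subsetI)
      fix c :: 'f and z
      assume "norm c \<le> 1" "z \<in> ?U"
      then have "ennreal (norm c) * ?q z \<le> 1 * ennreal e"
        by (intro mult_mono) auto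
      then show "smul c z \<in> ?U"
        by (simp add: gelfand_nn_integral_scale)
    qed
    show "closed ?U"
    proof (rule metrizable_closed_sequentially)
      fix s l
      assume "range s \<subseteq> ?U" "s \<longlonglongrightarrow> l"
      then have "?q l \<le> liminf (\<lambda>n. ?q (s n))" and "\<And>n. ?q (s n) \<le> e"
        using gelfand_nn_integral_liminf by auto
      moreover have "liminf (\<lambda>n. ?q (s n)) \<le> liminf (\<lambda>n. ennreal e)"
        using \<open>\<And>n. ?q (s n) \<le> e\<close> by (intro Liminf_mono) auto
      ultimately show "l \<in> ?U"
        by (simp add: Liminf_const order_trans)
    qed fact
  qed
qed

lemma gelfand_nn_integral_near:
  fixes e :: real
  assumes "metrizable_space (euclidean :: 'z topology)" and "barrelled_space smul" and "0 < e"
  shows "\<exists>S. open S \<and> y \<in> S \<and> (\<forall>z\<in>S. (\<integral>\<^sup>+x. norm (\<psi> x (z - y)) \<partial>M) \<le> e)"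
proof (intro exI conjI ballI)
  let ?U = "{z. (\<integral>\<^sup>+x. norm (\<psi> x z) \<partial>M) \<le> e}"
  show "open ((\<lambda>z. z - y) -` interior ?U)"
    by (intro open_vimage continuous_intros) auto
  show "y \<in> (\<lambda>z. z - y) -` interior ?U"
    using gelfand_barrel[OF assms] by simp
  show "(\<integral>\<^sup>+x. norm (\<psi> x (z - y)) \<partial>M) \<le> e" if "z \<in> (\<lambda>z. z - y) -` interior ?U" for z
    using that interior_subset[of ?U] by auto
qed

lemma set_integrable_gelfand:
  assumes "E \<in> sets M"
  shows "set_integrable M E (\<lambda>x. \<psi> x z)"
  using gelf assms unfolding gelfand_integrable_def set_integrable_def
  by (intro integrable_mult_indicator) auto

lemma linear_gelfand_integral:
  assumes "E \<in> sets M" "vector_space smul"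
  shows "Vector_Spaces.linear smul (*) (gelfand_integral M \<psi> E)"
proof -
  interpret vector_space smul by fact
  have "gelfand_integral M \<psi> E (y + z) = gelfand_integral M \<psi> E y + gelfand_integral M \<psi> E z" for y z
  proof -
    have "gelfand_integral M \<psi> E (y + z) = (LINT x:E|M. \<psi> x y + \<psi> x z)"
      unfolding gelfand_integral_def using assms(1) sets.sets_into_space[OF assms(1)]
      by (intro set_lebesgue_integral_cong) (auto intro!: gelfand_simps)
    then show ?thesis
      using assms(1) by (simp add: gelfand_integral_def set_integral_add set_integrable_gelfand)
  qed
  moreover have "gelfand_integral M \<psi> E (smul c z) = c * gelfand_integral M \<psi> E z" for c z
  proof -
    have "gelfand_integral M \<psi> E (smul c z) = (LINT x:E|M. c * \<psi> x z)"
      unfolding gelfand_integral_def using assms(1) sets.sets_into_space[OF assms(1)]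
      by (intro set_lebesgue_integral_cong) (auto intro!: gelfand_simps)
    then show ?thesis
      by (simp add: gelfand_integral_def)
  qed
  ultimately show ?thesis
    by unfold_locales (auto simp: algebra_simps)
qed

lemma norm_gelfand_integral_diff_le:
  assumes "E \<in> sets M" "F \<in> sets M"
  shows "ennreal (norm (gelfand_integral M \<psi> E z - gelfand_integral M \<psi> F z))
           \<le> (\<integral>\<^sup>+x\<in>sym_diff E F. norm (\<psi> x z) \<partial>M)"
proof -
  let ?h = "\<lambda>x. indicat_real E x *\<^sub>R \<psi> x z - indicat_real F x *\<^sub>R \<psi> x z"
  have int: "integrable M (\<lambda>x. indicat_real E x *\<^sub>R \<psi> x z)" "integrable M (\<lambda>x. indicat_real F x *\<^sub>R \<psi> x z)"
    using set_integrable_gelfand[OF assms(1)] set_integrable_gelfand[OF assms(2)]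
    by (simp_all add: set_integrable_def)
  have "gelfand_integral M \<psi> E z - gelfand_integral M \<psi> F z = (\<integral>x. ?h x \<partial>M)"
    using int by (simp add: gelfand_integral_def set_lebesgue_integral_def)
  also have "ennreal (norm \<dots>) \<le> (\<integral>\<^sup>+x. norm (?h x) \<partial>M)"
    using int by (intro integral_norm_bound_ennreal) auto
  also have "\<dots> = (\<integral>\<^sup>+x\<in>sym_diff E F. norm (\<psi> x z) \<partial>M)"
    by (intro nn_integral_cong) (auto simp: indicator_def)
  finally show ?thesis .
qed

lemma gelfand_integral_in_dual:
  assumes "metrizable_space (euclidean :: 'z topology)" and "barrelled_space smul" and E: "E \<in> sets M"
  shows "gelfand_integral M \<psi> E \<in> topological_dual smul"
proof -
  interpret barrelled_space smul by fact
  interpret I: Vector_Spaces.linear smul "(*)" "gelfand_integral M \<psi> E"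
    using E vector_space_axioms by (rule linear_gelfand_integral)
  have "(gelfand_integral M \<psi> E \<longlongrightarrow> gelfand_integral M \<psi> E y) (at y)" for y
  proof (rule tendstoI)
    fix e :: real assume "0 < e"
    then have "0 < e / 2" by simp
    obtain S where S: "open S" "y \<in> S" "\<And>z. z \<in> S \<Longrightarrow> (\<integral>\<^sup>+x. norm (\<psi> x (z - y)) \<partial>M) \<le> ennreal (e / 2)"
      using gelfand_nn_integral_near[OF assms(1,2) \<open>0 < e / 2\<close>] by metis
    have "dist (gelfand_integral M \<psi> E z) (gelfand_integral M \<psi> E y) < e" if "z \<in> S" for z
    proof -
      have "ennreal (norm (gelfand_integral M \<psi> E (z - y))) \<le> (\<integral>\<^sup>+x\<in>E. norm (\<psi> x (z - y)) \<partial>M)"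
        \<comment> \<open>the bound for the difference with the integral over the empty set, which is 0\<close>
        using norm_gelfand_integral_diff_le[OF E, of "{}"]
        by (simp add: gelfand_integral_def set_lebesgue_integral_def)
      also have "\<dots> \<le> (\<integral>\<^sup>+x. norm (\<psi> x (z - y)) \<partial>M)"
        by (intro nn_integral_mono) (auto simp: indicator_def)
      also have "\<dots> \<le> ennreal (e / 2)"
        using S(3) that .
      finally have "norm (gelfand_integral M \<psi> E (z - y)) \<le> e / 2"
        using \<open>0 < e\<close> by (simp add: ennreal_le_iff)
      then show ?thesis
        using \<open>0 < e\<close> by (simp add: dist_norm I.diff)
    qed
    then show "\<forall>\<^sub>F z in at y. dist (gelfand_integral M \<psi> E z) (gelfand_integral M \<psi> E y) < e"
      using S(1,2) unfolding eventually_at_topological by blast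
  qed
  then show ?thesis
    using I.linear_axioms by (simp add: topological_dual_def continuous_on_def)
qed

text \<open>The heart of the argument: the absolute continuity of the integrals is uniform on bounded
  sets, because these are totally bounded for \<open>q\<close>.\<close>

lemma gelfand_uniformly_absolutely_continuous:
  fixes e :: real
  assumes metr: "metrizable_space (euclidean :: 'z topology)" and "montel_space smul"
    and B: "tvs_bounded smul B" and e: "0 < e"
  shows "\<exists>\<delta>>0. \<forall>D\<in>sets M. emeasure M D < \<delta> \<longrightarrow> (\<forall>z\<in>B. (\<integral>\<^sup>+x\<in>D. norm (\<psi> x z) \<partial>M) \<le> e)"
proof -
  interpret montel_space smul by fact
  have "0 < e / 2" using e by simp
  have "compact (closure B)"
    using tvs_bounded_closure[OF B] by (intro closed_bounded_compact) auto
  have "\<exists>S. open S \<and> y \<in> S \<and> (\<forall>z\<in>S. (\<integral>\<^sup>+x. norm (\<psi> x (z - y)) \<partial>M) \<le> ennreal (e / 2))" for y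
    using metr barrelled_space_axioms \<open>0 < e / 2\<close> by (rule gelfand_nn_integral_near)
  then obtain S where S: "\<And>y. open (S y)" "\<And>y. y \<in> S y"
      "\<And>y z. z \<in> S y \<Longrightarrow> (\<integral>\<^sup>+x. norm (\<psi> x (z - y)) \<partial>M) \<le> ennreal (e / 2)"
    by metis
  have "closure B \<subseteq> (\<Union>y\<in>UNIV. S y)"
    using S(2) by auto
  with \<open>compact (closure B)\<close> S(1)
  obtain Y where Y: "finite Y" "closure B \<subseteq> (\<Union>y\<in>Y. S y)"
    by (rule compactE_image)
  have "\<exists>\<delta>>0. \<forall>D\<in>sets M. emeasure M D < \<delta> \<longrightarrow> (\<integral>\<^sup>+x\<in>D. norm (\<psi> x y) \<partial>M) \<le> ennreal (e / 2)" for y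
  proof -
    have "(\<lambda>x. ennreal (norm (\<psi> x y))) \<in> borel_measurable M"
      by measurable
    then show ?thesis
      using gelfand_nn_integral_finite \<open>0 < e / 2\<close> by (rule nn_integral_absolutely_continuous)
  qed
  then obtain \<delta> :: "'z \<Rightarrow> ennreal" where \<delta>: "\<And>y. 0 < \<delta> y"
      "\<And>y D. D \<in> sets M \<Longrightarrow> emeasure M D < \<delta> y \<Longrightarrow> (\<integral>\<^sup>+x\<in>D. norm (\<psi> x y) \<partial>M) \<le> ennreal (e / 2)"
    by metis
  show ?thesis
  proof (intro exI[of _ "Min (insert 1 (\<delta> ` Y))"] conjI ballI impI)
    \<comment> \<open>The element 1 keeps the minimum defined when \<open>Y\<close> is empty.\<close>
    show "0 < Min (insert 1 (\<delta> ` Y))"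
      using Y(1) \<delta>(1) by simp
    fix D z
    assume [measurable]: "D \<in> sets M" and D: "emeasure M D < Min (insert 1 (\<delta> ` Y))" and "z \<in> B"
    then obtain y where y: "y \<in> Y" "z \<in> S y"
      using Y(2) closure_subset[of B] by blast
    have "(\<integral>\<^sup>+x\<in>D. norm (\<psi> x z) \<partial>M)
        \<le> (\<integral>\<^sup>+x. ennreal (norm (\<psi> x y)) * indicator D x + ennreal (norm (\<psi> x (z - y))) \<partial>M)"
    proof (intro nn_integral_mono)
      fix x assume "x \<in> space M"
      then have "norm (\<psi> x z) \<le> norm (\<psi> x y) + norm (\<psi> x (z - y))"
        using norm_triangle_sub[of "\<psi> x z" "\<psi> x y"] by (simp add: gelfand_simps)
      then show "ennreal (norm (\<psi> x z)) * indicator D x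
          \<le> ennreal (norm (\<psi> x y)) * indicator D x + ennreal (norm (\<psi> x (z - y)))"
        by (auto simp: indicator_def ennreal_leI simp flip: ennreal_plus)
    qed
    also have "\<dots> = (\<integral>\<^sup>+x\<in>D. norm (\<psi> x y) \<partial>M) + (\<integral>\<^sup>+x. norm (\<psi> x (z - y)) \<partial>M)"
      by (intro nn_integral_add) measurable
    also have "\<dots> \<le> ennreal (e / 2) + ennreal (e / 2)"
      using D y Y(1) by (intro add_mono \<delta>(2) S(3)) auto
    also have "\<dots> = ennreal e"
      using e by (simp flip: ennreal_plus)
    finally show "(\<integral>\<^sup>+x\<in>D. norm (\<psi> x z) \<partial>M) \<le> e" .
  qed
qed

end

section \<open>Continuity into the strong dual\<close>

lemma dual_seminorm_triangle:
  "dual_seminorm B (\<lambda>z. f z - h z) \<le> dual_seminorm B (\<lambda>z. f z - g z) + dual_seminorm B (\<lambda>z. g z - h z)"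
  unfolding dual_seminorm_def
proof (rule SUP_least)
  fix z assume "z \<in> B"
  have "ennreal (norm (f z - h z)) \<le> ennreal (norm (f z - g z)) + ennreal (norm (g z - h z))"
    using norm_triangle_ineq[of "f z - g z" "g z - h z"] by (simp add: ennreal_leI flip: ennreal_plus)
  also have "\<dots> \<le> (SUP z\<in>B. ennreal (norm (f z - g z))) + (SUP z\<in>B. ennreal (norm (g z - h z)))"
    using \<open>z \<in> B\<close> by (intro add_mono SUP_upper)
  finally show "ennreal (norm (f z - h z)) \<le> \<dots>" .
qed

theorem proposition3p6:
  fixes M :: "'m measure"
    and smul :: "'f::real_or_complex \<Rightarrow> 'z::topological_ab_group_add \<Rightarrow> 'z"
    and \<psi> :: "'m \<Rightarrow> 'z \<Rightarrow> 'f"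
  assumes "sigma_finite_measure M"
    and "frechet_space smul"
    and "gelfand_integrable smul M \<psi>"
    and "montel_space smul"
  shows "continuous_map (nikodym_topology M) (strong_topology smul) (gelfand_integral_class M \<psi>)"
proof -
  interpret montel_space smul by fact
  have metr: "metrizable_space (euclidean :: 'z topology)"
    using assms(2) by (rule frechet_space.metrizable)
  let ?C = "sets M // nikodym_rel M"
  have top: "topspace (nikodym_topology M) = ?C"
    by (simp add: nikodym_topology_def topspace_emetric_topology)
  have dual: "gelfand_integral_class M \<psi> A \<in> topological_dual smul" if "A \<in> ?C" for A
    using that gelfand_integral_in_dual[OF assms(3) metr barrelled_space_axioms]
    by (auto elim!: quotientE simp: gelfand_integral_class[OF assms(3)])
  have "gelfand_integral_class M \<psi> ` topspace (nikodym_topology M) \<subseteq> topspace (strong_topology smul)"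
    using dual by (auto simp: top topspace_strong_topology)
  then show ?thesis
    unfolding strong_topology_def topology_generated_by_topspace
  proof (rule continuous_on_generated_topo[rotated])
    fix W
    assume "W \<in> {{g \<in> topological_dual smul. dual_seminorm B (\<lambda>z. g z - f z) < e} | B f e.
        tvs_bounded smul B \<and> f \<in> topological_dual smul \<and> 0 < e}"
    then obtain B f e where W: "W = {g \<in> topological_dual smul. dual_seminorm B (\<lambda>z. g z - f z) < e}"
      and B: "tvs_bounded smul B" by blast
    have "\<exists>\<delta>>0. \<forall>A'\<in>?C. nikodym_dist M A A' < \<delta> \<longrightarrow> gelfand_integral_class M \<psi> A' \<in> W"
      if A: "A \<in> ?C" and AW: "gelfand_integral_class M \<psi> A \<in> W" for A
    proof -
      obtain E where E: "E \<in> sets M" "A = nikodym_rel M `` {E}"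
        using A by (rule quotientE)
      let ?s = "dual_seminorm B (\<lambda>z. gelfand_integral M \<psi> E z - f z)"
      have "?s < e"
        using AW by (simp add: W E gelfand_integral_class[OF assms(3)])
      \<comment> \<open>The radius \<open>e\<close> may be infinite; the intermediate value \<open>t\<close> leaves a positive real
        distance \<open>r\<close> to the seminorm at \<open>A\<close>.\<close>
      then obtain t where t: "?s < t" "t < e"
        using dense by blast
      then have "0 < t - ?s" "t - ?s \<noteq> \<infinity>"
        by (auto simp: diff_gt_0_iff_gt_ennreal)
      then obtain r where r: "t - ?s = ennreal r" "0 < r"
        by (cases "t - ?s") auto
      obtain \<delta> where \<delta>: "0 < \<delta>" "\<And>D z. D \<in> sets M \<Longrightarrow> emeasure M D < \<delta> \<Longrightarrow> z \<in> B \<Longrightarrow>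
          (\<integral>\<^sup>+x\<in>D. norm (\<psi> x z) \<partial>M) \<le> ennreal r"
        using gelfand_uniformly_absolutely_continuous[OF assms(3) metr assms(4) B r(2)] by metis
      have "gelfand_integral_class M \<psi> A' \<in> W" if A': "A' \<in> ?C" "nikodym_dist M A A' < \<delta>" for A'
      proof -
        obtain F where F: "F \<in> sets M" "A' = nikodym_rel M `` {F}"
          using A'(1) by (rule quotientE)
        have small: "emeasure M (sym_diff F E) < \<delta>"
          using A'(2) E F by (simp add: nikodym_dist_class Un_commute)
        have "dual_seminorm B (\<lambda>z. gelfand_integral M \<psi> F z - gelfand_integral M \<psi> E z) \<le> ennreal r"
          unfolding dual_seminorm_def
        proof (rule SUP_least)
          fix z assume "z \<in> B"
          have "sym_diff F E \<in> sets M"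
            using E(1) F(1) by auto
          from order_trans[OF norm_gelfand_integral_diff_le[OF assms(3) F(1) E(1)] \<delta>(2)[OF this small \<open>z \<in> B\<close>]]
          show "ennreal (norm (gelfand_integral M \<psi> F z - gelfand_integral M \<psi> E z)) \<le> ennreal r" .
        qed
        then have "dual_seminorm B (\<lambda>z. gelfand_integral M \<psi> F z - f z) \<le> (t - ?s) + ?s"
          unfolding r(1) by (rule order_trans[OF dual_seminorm_triangle[where g = "gelfand_integral M \<psi> E"] add_right_mono])
        also have "\<dots> = t"
          using t(1) by (simp add: diff_add_cancel_ennreal)
        also note t(2)
        finally show ?thesis
          using dual[OF A'(1)] by (simp add: W F gelfand_integral_class[OF assms(3)])
      qed
      then show ?thesis
        using \<delta>(1) by blast
    qed
    then show "openin (nikodym_topology M) (gelfand_integral_class M \<psi> -` W \<inter> topspace (nikodym_topology M))"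
      unfolding top unfolding nikodym_topology_def openin_emetric_topology by auto
  qed
qed

end
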